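(* Let $(G,+)$ be an abelian group and let $A,B$ be non-empty finite subsets of $G$ with $\# A=\# B$ and $0\notin B$. If $A$ is locally matched to $B$, then $A$ is matched to $B$, i.e. there exists a bijection $f:A\to B$ such that $a+f(a)\notin A$ for all $a\in A$.
   Context: For finite subsets $A,B$ of an abelian group $G$, a matching from $A$ to $B$ is a bijection $f:A\to B$ with $a+f(a)\notin A$ for all $a\in A$; $A$ is matched to $B$ if such a matching exists. $A$ is said to be locally matched to $B$ if for every proper subgroup $H<G$ such that $H\cap B\neq\emptyset$ and $a+H\subseteq A$ for some $a\in A$, there exist a subset $A'\subseteq A$ and a bijection $f:A'\to H\cap B$ such that $a+f(a)\notin A$ for all $a\in A'$. *)

theory Defs
  imports "HOL-Algebra.Coset"
begin

text \<open>
  The group is written multiplicatively, following HOL-Algebra: the sum \<open>a + b\<close> is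
  \<open>a \<otimes> b\<close>, the neutral element \<open>0\<close> is \<open>\<one>\<close>, and the coset \<open>a + H\<close> is \<open>a <# H\<close>.
\<close>

definition matching :: "('a, 'm) monoid_scheme \<Rightarrow> 'a set \<Rightarrow> 'a set \<Rightarrow> ('a \<Rightarrow> 'a) \<Rightarrow> bool"
  where "matching G A B f \<longleftrightarrow> bij_betw f A B \<and> (\<forall>a\<in>A. a \<otimes>\<^bsub>G\<^esub> f a \<notin> A)"

definition matched :: "('a, 'm) monoid_scheme \<Rightarrow> 'a set \<Rightarrow> 'a set \<Rightarrow> bool"
  where "matched G A B \<longleftrightarrow> (\<exists>f. matching G A B f)"

text \<open>
  In the local notion the products \<open>a \<otimes> f a\<close> have to avoid the whole set \<open>A\<close>, not only the
  domain \<open>A'\<close> of the bijection, so \<open>f\<close> is in general more than a matching from \<open>A'\<close> to \<open>H \<inter> B\<close>.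
\<close>

definition locally_matched :: "('a, 'm) monoid_scheme \<Rightarrow> 'a set \<Rightarrow> 'a set \<Rightarrow> bool"
  where "locally_matched G A B \<longleftrightarrow>
    (\<forall>H. subgroup H G \<and> H \<noteq> carrier G \<and> H \<inter> B \<noteq> {} \<and> (\<exists>a\<in>A. a <#\<^bsub>G\<^esub> H \<subseteq> A) \<longrightarrow>
      (\<exists>A' f. A' \<subseteq> A \<and> bij_betw f A' (H \<inter> B) \<and> (\<forall>a\<in>A'. a \<otimes>\<^bsub>G\<^esub> f a \<notin> A)))"

end

theory Submission
  imports Defs
begin

text \<open>
  If \<open>A\<close> is not matched to \<open>B\<close>, Hall's theorem yields \<open>S \<subseteq> A\<close> such that the set \<open>U\<close> of all
  \<open>b \<in> B\<close> with \<open>S + b \<subseteq> A\<close> satisfies \<open>|S| + |U| > |A|\<close>.  Iterated Dyson transforms of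
  \<open>S\<close> and \<open>U \<union> {0}\<close> give a subgroup \<open>H\<close> and a nonempty \<open>H\<close>-periodic set
  \<open>C \<subseteq> S + (U \<union> {0}) \<subseteq> A\<close> with \<open>|C| \<ge> |S| + |U - H|\<close>; this weak form of Kneser's theorem
  is enough.  The set \<open>A'\<close> provided by the local matching for \<open>H\<close> is disjoint from \<open>C\<close>
  because \<open>C + H = C \<subseteq> A\<close>, so \<open>|A| \<ge> |C| + |H \<inter> B| \<ge> |S| + |U|\<close>, a contradiction.
\<close>

text \<open>
  The Halmos--Vaughan proof: either Hall's condition is strict on nonempty proper subsets of the
  index set, so that any first choice can be extended, or a tight subset splits the problem.
\<close>

lemma hall_marriage:
  fixes N :: "'i \<Rightarrow> 'b set"
  assumes "finite I" "\<And>i. i \<in> I \<Longrightarrow> finite (N i)"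
    and "\<And>J. J \<subseteq> I \<Longrightarrow> card J \<le> card (\<Union>(N ` J))"
  shows "\<exists>f. inj_on f I \<and> (\<forall>i\<in>I. f i \<in> N i)"
  using assms
proof (induction "card I" arbitrary: I N rule: less_induct)
  case less
  note fin = less.prems(1) and finN = less.prems(2) and hall = less.prems(3)
  have finU: "finite (\<Union>(N ` J))" if "J \<subseteq> I" for J
    using that fin finN by (blast intro: finite_subset)
  show ?case
  proof (cases "\<exists>J. J \<subset> I \<and> J \<noteq> {} \<and> card J = card (\<Union>(N ` J))")
    case True
    then obtain J where J: "J \<subset> I" "J \<noteq> {}" "card J = card (\<Union>(N ` J))"
      by blast
    define V where "V = \<Union>(N ` J)"
    have finJ: "finite J"
      using J(1) fin by (meson finite_subset psubset_imp_subset)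
    have "\<exists>f. inj_on f J \<and> (\<forall>i\<in>J. f i \<in> N i)"
      using J(1) fin finJ finN by (intro less.hyps psubset_card_mono hall) auto
    then obtain f where f: "inj_on f J" "\<And>i. i \<in> J \<Longrightarrow> f i \<in> N i"
      by blast
    \<comment> \<open>The values in \<open>V\<close> stay reserved for \<open>J\<close>. Since
      \<open>card V = card J\<close>, Hall's condition for \<open>K \<union> J\<close> leaves at
      least \<open>card K\<close> values outside \<open>V\<close>.\<close>
    have "\<exists>g. inj_on g (I - J) \<and> (\<forall>i\<in>I - J. g i \<in> N i - V)"
    proof (rule less.hyps)
      show "card (I - J) < card I"
        using J(1,2) fin by (intro psubset_card_mono) auto
      fix K assume K: "K \<subseteq> I - J"
      have "finite K"
        using K fin by (meson finite_Diff finite_subset)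
      hence "card K + card J = card (K \<union> J)"
        using K finJ by (subst card_Un_disjoint) auto
      also have "\<dots> \<le> card (\<Union>(N ` (K \<union> J)))"
        using K J(1) by (intro hall) auto
      also have "\<Union>(N ` (K \<union> J)) = (\<Union>i\<in>K. N i - V) \<union> V"
        by (auto simp: V_def)
      also have "card \<dots> \<le> card (\<Union>i\<in>K. N i - V) + card V"
        by (rule card_Un_le)
      finally show "card K \<le> card (\<Union>i\<in>K. N i - V)"
        using J(3) by (simp add: V_def)
    qed (use fin finN in auto)
    then obtain g where g: "inj_on g (I - J)" "\<And>i. i \<in> I - J \<Longrightarrow> g i \<in> N i - V"
      by blast
    have fV: "f i \<in> V" if "i \<in> J" for i
      using f(2) that by (auto simp: V_def)
    have "f ` J \<inter> g ` (I - J) = {}"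
      using fV g(2) by fastforce
    hence "inj_on (\<lambda>i. if i \<in> J then f i else g i) (J \<union> (I - J))"
      by (rule inj_on_disjoint_Un[OF f(1) g(1)])
    moreover have "J \<union> (I - J) = I"
      using J(1) by blast
    ultimately have "inj_on (\<lambda>i. if i \<in> J then f i else g i) I"
      by simp
    moreover have "\<forall>i\<in>I. (if i \<in> J then f i else g i) \<in> N i"
      using f(2) g(2) by auto
    ultimately show ?thesis
      by blast
  next
    case False
    hence strict: "card J < card (\<Union>(N ` J))" if "J \<subset> I" "J \<noteq> {}" for J
      using that hall[of J] by (metis le_neq_implies_less psubset_imp_subset)
    show ?thesis
    proof (cases "I = {}")
      case False
      then obtain i where i: "i \<in> I"
        by blast
      have "card {i} \<le> card (\<Union>(N ` {i}))"
        using i by (intro hall) auto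
      then obtain x where x: "x \<in> N i"
        by fastforce
      have "\<exists>g. inj_on g (I - {i}) \<and> (\<forall>j\<in>I - {i}. g j \<in> N j - {x})"
      proof (rule less.hyps)
        show "card (I - {i}) < card I"
          using i fin by (intro psubset_card_mono) auto
        fix K assume K: "K \<subseteq> I - {i}"
        show "card K \<le> card (\<Union>j\<in>K. N j - {x})"
        proof (cases "K = {}")
          case False
          \<comment> \<open>The strict inequality pays for the single value \<open>x\<close> that is
            removed.\<close>
          have "card K < card (\<Union>(N ` K))"
            using K i False by (intro strict) auto
          moreover have "(\<Union>j\<in>K. N j - {x}) = \<Union>(N ` K) - {x}"
            by auto
          moreover have "card (\<Union>(N ` K)) \<le> card (\<Union>(N ` K) - {x}) + 1"
            using diff_card_le_card_Diff[of "{x}" "\<Union>(N ` K)"] by simp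
          ultimately show ?thesis
            by simp
        qed simp
      qed (use fin finN in auto)
      then obtain g where g: "inj_on g (I - {i})" "\<And>j. j \<in> I - {i} \<Longrightarrow> g j \<in> N j - {x}"
        by blast
      have "inj_on (g(i := x)) I"
      proof -
        have "x \<notin> g ` (I - {i})"
          using g(2) by blast
        hence "inj_on (g(i := x)) (I - {i})" "(g(i := x)) i \<notin> (g(i := x)) ` (I - {i} - {i})"
          using inj_on_fun_updI[OF g(1)] by auto
        hence "inj_on (g(i := x)) (insert i (I - {i}))"
          by (simp only: inj_on_insert simp_thms)
        thus ?thesis
          by (simp only: insert_Diff[OF i])
      qed
      moreover have "\<forall>j\<in>I. (g(i := x)) j \<in> N j"
        using g(2) x by auto
      ultimately show ?thesis
        by blast
    qed simp
  qed
qed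

lemma (in group) subgroup_stabilizer:
  assumes "S \<subseteq> carrier G"
  shows "subgroup {h \<in> carrier G. S #> h = S} G"
proof (rule subgroupI)
  show "{h \<in> carrier G. S #> h = S} \<noteq> {}"
    using assms by (auto intro!: exI[of _ \<one>])
  fix h assume h: "h \<in> {h \<in> carrier G. S #> h = S}"
  thus "inv h \<in> {h \<in> carrier G. S #> h = S}"
    using coset_mult_assoc[OF assms, of h "inv h"] assms by auto
next
  fix h k assume "h \<in> {h \<in> carrier G. S #> h = S}" "k \<in> {h \<in> carrier G. S #> h = S}"
  thus "h \<otimes> k \<in> {h \<in> carrier G. S #> h = S}"
    using assms by (auto simp flip: coset_mult_assoc)
qed auto

text \<open>Induction on \<open>card T\<close>. If \<open>S <#> T \<subseteq> S\<close>, take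
  \<open>C = S\<close> and its stabilizer as \<open>H\<close>. Otherwise a Dyson transform at some
  \<open>e \<in> S\<close> turns every \<open>t \<in> T\<close> with
  \<open>e \<otimes> t \<notin> S\<close> into the new element \<open>e \<otimes> t\<close> of
  \<open>S\<close>. This preserves \<open>card S + card T\<close>, does not enlarge the product set
  and shrinks \<open>T\<close>.\<close>

lemma (in comm_group) exists_periodic_subset_of_product:
  assumes "S \<subseteq> carrier G" "finite S" "S \<noteq> {}"
    and "T \<subseteq> carrier G" "finite T" "\<one> \<in> T"
  shows "\<exists>H C. subgroup H G \<and> C \<noteq> {} \<and> C \<subseteq> S <#> T \<and> C <#> H \<subseteq> C \<and>
    card S + card (T - H) \<le> card C"
  using assms
proof (induction "card T" arbitrary: S T rule: less_induct)
  case less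
  note S = less.prems(1-3) and T = less.prems(4-6)
  show ?case
  proof (cases "S <#> T \<subseteq> S")
    case True
    define H where "H = {h \<in> carrier G. S #> h = S}"
    \<comment> \<open>Translation preserves cardinality, so for finite \<open>S\<close> the
      inclusion \<open>S #> t \<subseteq> S\<close> is an equality.\<close>
    have "S #> t = S" if "t \<in> T" for t
    proof (rule card_subset_eq)
      show "S #> t \<subseteq> S"
        using True that by (auto simp: set_mult_def r_coset_def)
      show "card (S #> t) = card S"
        using S(1) T(1) that by (intro card_rcosets_equal[symmetric]) (auto intro: rcosetsI)
    qed fact
    hence "T \<subseteq> H"
      using T by (auto simp: H_def)
    moreover have "subgroup H G"
      unfolding H_def using S(1) by (rule subgroup_stabilizer)
    moreover have "S <#> H \<subseteq> S"
      by (auto simp: H_def set_mult_def r_coset_def)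
    moreover have "S \<subseteq> S <#> T"
      using S(1) T(3) by (force simp: set_mult_def)
    ultimately show ?thesis
      using S(3) by (intro exI[of _ H] exI[of _ S]) (simp add: Diff_eq_empty_iff[THEN iffD2])
  next
    case False
    then obtain e t where et: "e \<in> S" "t \<in> T" "e \<otimes> t \<notin> S"
      by (auto simp: set_mult_def)
    have e: "e \<in> carrier G"
      using et(1) S(1) by auto
    \<comment> \<open>\<open>T'\<close> still contains \<open>\<one>\<close> because
      \<open>e \<in> S\<close>, and it is smaller than \<open>T\<close> because it lacks the
      \<open>t\<close> chosen above.\<close>
    define T' where "T' = {t \<in> T. e \<otimes> t \<in> S}"
    define S' where "S' = S \<union> (\<lambda>t. e \<otimes> t) ` (T - T')"
    have inj: "inj_on (\<lambda>t. e \<otimes> t) (T - T')"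
      using inj_on_cmult[OF e] by (rule inj_on_subset) (use T(1) in auto)
    have card_S': "card S' = card S + card (T - T')"
      unfolding S'_def using S(2) T(2) card_image[OF inj]
      by (subst card_Un_disjoint) (auto simp: T'_def)
    have "\<exists>H C. subgroup H G \<and> C \<noteq> {} \<and> C \<subseteq> S' <#> T' \<and> C <#> H \<subseteq> C \<and>
        card S' + card (T' - H) \<le> card C"
    proof (rule less.hyps)
      show "card T' < card T"
        using et T(2) by (intro psubset_card_mono) (auto simp: T'_def)
    qed (use S T e et(1) in \<open>auto simp: S'_def T'_def\<close>)
    then obtain H C where HC: "subgroup H G" "C \<noteq> {}" "C \<subseteq> S' <#> T'" "C <#> H \<subseteq> C"
        "card S' + card (T' - H) \<le> card C"
      by blast
    have "S' <#> T' \<subseteq> S <#> T"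
    proof
      fix x assume "x \<in> S' <#> T'"
      then obtain s t where st: "s \<in> S'" "t \<in> T'" "x = s \<otimes> t"
        by (auto simp: set_mult_def)
      show "x \<in> S <#> T"
      proof (cases "s \<in> S")
        case True
        thus ?thesis
          using st by (auto simp: set_mult_def T'_def)
      next
        case False
        then obtain u where u: "u \<in> T" "s = e \<otimes> u"
          using st(1) by (auto simp: S'_def)
        \<comment> \<open>Commutativity swaps the roles of \<open>t\<close> and \<open>u\<close>:
          the definition of \<open>T'\<close> puts \<open>e \<otimes> t\<close> in \<open>S\<close>,
          and \<open>u\<close> is in \<open>T\<close>.\<close>
        have "x = (e \<otimes> t) \<otimes> u"
          using st u e T(1) by (auto simp: T'_def m_ac subset_iff)
        thus ?thesis
          using st(2) u(1) by (auto simp: set_mult_def T'_def)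
      qed
    qed
    \<comment> \<open>The elements that left \<open>T\<close> may lie outside \<open>H\<close>, but
      each is compensated by a new element of \<open>S'\<close>.\<close>
    moreover have "card (T - H) \<le> card (T - T') + card (T' - H)"
    proof -
      have "card (T - H) \<le> card ((T - T') \<union> (T' - H))"
        using T(2) by (intro card_mono) (auto simp: T'_def)
      thus ?thesis
        using card_Un_le[of "T - T'" "T' - H"] by linarith
    qed
    ultimately have "C \<subseteq> S <#> T" "card S + card (T - H) \<le> card C"
      using HC(3,5) card_S' by (blast, linarith)
    thus ?thesis
      using HC(1,2,4) by blast
  qed
qed

theorem theorem3p1:
  fixes G :: "('a, 'm) monoid_scheme" and A B :: "'a set"
  assumes "comm_group G"
    and "A \<subseteq> carrier G" and "B \<subseteq> carrier G"
    and "finite A" and "finite B"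
    and "A \<noteq> {}" and "B \<noteq> {}"
    and "card A = card B"
    and "\<one>\<^bsub>G\<^esub> \<notin> B"
    and "locally_matched G A B"
  shows "matched G A B"
proof (rule ccontr)
  interpret comm_group G by fact
  note A = \<open>A \<subseteq> carrier G\<close> \<open>finite A\<close> and B = \<open>B \<subseteq> carrier G\<close> \<open>finite B\<close>
  define N where "N = (\<lambda>a. {b \<in> B. a \<otimes>\<^bsub>G\<^esub> b \<notin> A})"
  assume not_matched: "\<not> matched G A B"
  have "\<not> (\<forall>S\<subseteq>A. card S \<le> card (\<Union>(N ` S)))"
  proof
    assume "\<forall>S\<subseteq>A. card S \<le> card (\<Union>(N ` S))"
    then obtain f where f: "inj_on f A" "\<forall>a\<in>A. f a \<in> N a"
      using hall_marriage[of A N] A(2) B(2) by (auto simp: N_def)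
    have "f ` A = B"
      using f B(2) \<open>card A = card B\<close> by (intro card_subset_eq) (auto simp: N_def card_image)
    hence "matching G A B f"
      using f by (auto simp: matching_def bij_betw_def N_def)
    thus False
      using not_matched by (auto simp: matched_def)
  qed
  then obtain S where S: "S \<subseteq> A" "card (\<Union>(N ` S)) < card S"
    by (auto simp: not_le)
  have S': "S \<noteq> {}" "finite S"
    using S A(2) by (auto intro: finite_subset)
  define U where "U = B - \<Union>(N ` S)"
  have U: "U \<subseteq> B" "finite U"
    using B(2) by (auto simp: U_def)
  have "card B \<le> card (U \<union> \<Union>(N ` S))"
    using B(2) S'(2) by (intro card_mono) (auto simp: U_def N_def)
  also have "\<dots> \<le> card U + card (\<Union>(N ` S))"
    by (rule card_Un_le)
  finally have large: "card A < card S + card U"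
    using S(2) \<open>card A = card B\<close> by linarith
  have one_U: "insert \<one>\<^bsub>G\<^esub> U \<subseteq> carrier G" "finite (insert \<one>\<^bsub>G\<^esub> U)"
    using U B(1) by auto
  obtain H C where HC: "subgroup H G" "C \<noteq> {}" "C \<subseteq> S <#>\<^bsub>G\<^esub> insert \<one>\<^bsub>G\<^esub> U"
      "C <#>\<^bsub>G\<^esub> H \<subseteq> C" "card S + card (insert \<one>\<^bsub>G\<^esub> U - H) \<le> card C"
    using exists_periodic_subset_of_product[OF subset_trans[OF S(1) A(1)] S'(2,1) one_U insertI1]
    by blast
  have "\<one>\<^bsub>G\<^esub> \<in> H"
    using HC(1) by (rule subgroup.one_closed)
  hence card_C: "card S + card (U - H) \<le> card C"
    using HC(5) by simp
  have "S <#>\<^bsub>G\<^esub> insert \<one>\<^bsub>G\<^esub> U \<subseteq> A"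
    using S(1) A(1) by (auto simp: set_mult_def U_def N_def subset_iff)
  hence CA: "C \<subseteq> A"
    using HC(3) by blast
  have periodic: "c \<otimes>\<^bsub>G\<^esub> h \<in> C" if "c \<in> C" "h \<in> H" for c h
    using HC(4) that by (auto simp: set_mult_def)
  have U_split: "card U = card (U - H) + card (H \<inter> U)"
    using U(2) card_Int_Diff[of U H] by (simp add: Int_commute)
  \<comment> \<open>Otherwise \<open>U - H = U\<close>, so \<open>C\<close> would have at least
    \<open>card S + card U\<close> elements, more than \<open>A\<close>, which contains it.\<close>
  have "H \<inter> B \<noteq> {}"
  proof
    assume "H \<inter> B = {}"
    hence "card (H \<inter> U) = 0"
      using U(1) by (metis card.empty inf_mono order_refl subset_empty)
    thus False
      using card_C card_mono[OF A(2) CA] large U_split by linarith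
  qed
  moreover obtain c where c: "c \<in> C"
    using HC(2) by blast
  hence "c <#\<^bsub>G\<^esub> H \<subseteq> A"
    using periodic CA by (auto simp: l_coset_def)
  \<comment> \<open>If \<open>H\<close> were the whole group, the periodic set \<open>C\<close>
    would be the whole group too. Then \<open>A\<close>, and by cardinality \<open>B\<close>, would
    equal \<open>carrier G\<close>, against \<open>\<one> \<notin> B\<close>.\<close>
  moreover have "H \<noteq> carrier G"
  proof
    assume H: "H = carrier G"
    have "carrier G \<subseteq> A"
    proof
      fix x assume x: "x \<in> carrier G"
      have "c \<in> carrier G"
        using c CA A(1) by blast
      hence "c \<otimes>\<^bsub>G\<^esub> (inv\<^bsub>G\<^esub> c \<otimes>\<^bsub>G\<^esub> x) = x"
        using x by (simp add: m_assoc[symmetric])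
      thus "x \<in> A"
        using periodic[of c "inv\<^bsub>G\<^esub> c \<otimes>\<^bsub>G\<^esub> x"] c CA x \<open>c \<in> carrier G\<close> H by auto
    qed
    hence "B = A"
      using A B \<open>card A = card B\<close> by (intro card_subset_eq) auto
    thus False
      using \<open>carrier G \<subseteq> A\<close> \<open>\<one>\<^bsub>G\<^esub> \<notin> B\<close> by auto
  qed
  ultimately have "subgroup H G \<and> H \<noteq> carrier G \<and> H \<inter> B \<noteq> {} \<and> (\<exists>a\<in>A. a <#\<^bsub>G\<^esub> H \<subseteq> A)"
    using HC(1) c CA by blast
  from \<open>locally_matched G A B\<close>[unfolded locally_matched_def, rule_format, OF this]
  obtain A' f where A': "A' \<subseteq> A" "bij_betw f A' (H \<inter> B)"
      "\<forall>a\<in>A'. a \<otimes>\<^bsub>G\<^esub> f a \<notin> A"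
    by blast
  \<comment> \<open>For \<open>a\<close> in both sets, \<open>f a \<in> H\<close> and periodicity
    would put the product of \<open>a\<close> and \<open>f a\<close> in
    \<open>C \<subseteq> A\<close>.\<close>
  have "C \<inter> A' = {}"
    using A'(2,3) periodic CA by (force dest: bij_betwE)
  hence "card C + card A' = card (C \<union> A')"
    using CA A'(1) A(2) by (subst card_Un_disjoint) (auto intro: finite_subset)
  also have "\<dots> \<le> card A"
    using CA A'(1) A(2) by (intro card_mono) auto
  finally have "card C + card (H \<inter> B) \<le> card A"
    using bij_betw_same_card[OF A'(2)] by simp
  moreover have "card (H \<inter> U) \<le> card (H \<inter> B)"
    using U(1) B(2) by (intro card_mono) auto
  ultimately show False
    using card_C large U_split by linarith
qed

end
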